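(* Let $(A,d)$ be a dg-simple dg-algebra. Then the graded centre $Z_{gr}(A,d)$, with the restriction of $d$, is a dg-division algebra.
   Context: For a commutative ring $K$, a dg-$K$-algebra $(A,d)$ is a unital associative $\mathbb{Z}$-graded $K$-algebra $A$ with a graded $K$-linear endomorphism $d$ of degree $1$ such that $d^2=0$ and $d(ab)=d(a)b+(-1)^{|a|}a\,d(b)$ for all homogeneous $a,b\in A$. A dg-left, dg-right or twosided dg-ideal is a $\mathbb{Z}$-graded left, right or twosided ideal stable under $d$. $(A,d)$ is dg-simple if it contains no twosided dg-ideal other than $0$ and $A$. It is a dg-division algebra if it contains no dg-left ideal and no dg-right ideal other than $0$ and $A$. The graded centre $Z_{gr}(A)=Z_{gr}(A,d)$ is the graded subring of $A$ whose homogeneous elements are the homogeneous $b\in A$ with $ba=(-1)^{|a||b|}ab$ for all homogeneous $a\in A$; it is stable under $d$. *)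

theory Defs
  imports "HOL-Algebra.Algebra"
begin

record ('k, 'a) dg_struct = "('k, 'a) module" +
  hom_part :: "int \<Rightarrow> 'a set"
  diff :: "'a \<Rightarrow> 'a"

text \<open>\<open>x\<close> is the sum of the finitely supported family \<open>f\<close> with \<open>f n \<in> C n\<close>.\<close>

definition decomposes ::
    "('a, 'm) ring_scheme \<Rightarrow> (int \<Rightarrow> 'a set) \<Rightarrow> (int \<Rightarrow> 'a) \<Rightarrow> 'a \<Rightarrow> bool" where
  "decomposes A C f x \<longleftrightarrow>
     (\<forall>n. f n \<in> C n) \<and> finite {n. f n \<noteq> \<zero>\<^bsub>A\<^esub>} \<and> x = finsum A f {n. f n \<noteq> \<zero>\<^bsub>A\<^esub>}"

text \<open>\<open>signed A n x\<close> is \<open>(-1)^n x\<close>.\<close>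

definition signed :: "('a, 'm) ring_scheme \<Rightarrow> int \<Rightarrow> 'a \<Rightarrow> 'a" where
  "signed A n x = (if even n then x else \<ominus>\<^bsub>A\<^esub> x)"

text \<open>The library locale \<open>algebra\<close> is restricted to commutative algebras, so associative
  algebras are assembled here from \<open>module\<close> (which includes that \<open>K\<close> is a commutative ring)
  and \<open>ring\<close>. Unique decomposability says that \<open>A\<close> is the direct sum of its homogeneous
  parts. The zero element is homogeneous of every degree.\<close>

locale dg_algebra = module K A + ring A
  for K :: "('k, 'm) ring_scheme" and A :: "('k, 'a, 'n) dg_struct_scheme" +
  assumes smult_mult_left:
      "\<lbrakk>k \<in> carrier K; a \<in> carrier A; b \<in> carrier A\<rbrakk>
        \<Longrightarrow> (k \<odot>\<^bsub>A\<^esub> a) \<otimes>\<^bsub>A\<^esub> b = k \<odot>\<^bsub>A\<^esub> (a \<otimes>\<^bsub>A\<^esub> b)"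
    and smult_mult_right:
      "\<lbrakk>k \<in> carrier K; a \<in> carrier A; b \<in> carrier A\<rbrakk>
        \<Longrightarrow> a \<otimes>\<^bsub>A\<^esub> (k \<odot>\<^bsub>A\<^esub> b) = k \<odot>\<^bsub>A\<^esub> (a \<otimes>\<^bsub>A\<^esub> b)"
    and hom_part_submodule: "submodule (hom_part A n) K A"
    and hom_part_direct_sum: "x \<in> carrier A \<Longrightarrow> \<exists>!f. decomposes A (hom_part A) f x"
    and one_hom_part: "\<one>\<^bsub>A\<^esub> \<in> hom_part A 0"
    and mult_hom_part:
      "\<lbrakk>a \<in> hom_part A i; b \<in> hom_part A j\<rbrakk> \<Longrightarrow> a \<otimes>\<^bsub>A\<^esub> b \<in> hom_part A (i + j)"
    and diff_add:
      "\<lbrakk>x \<in> carrier A; y \<in> carrier A\<rbrakk> \<Longrightarrow> diff A (x \<oplus>\<^bsub>A\<^esub> y) = diff A x \<oplus>\<^bsub>A\<^esub> diff A y"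
    and diff_smult:
      "\<lbrakk>k \<in> carrier K; x \<in> carrier A\<rbrakk> \<Longrightarrow> diff A (k \<odot>\<^bsub>A\<^esub> x) = k \<odot>\<^bsub>A\<^esub> diff A x"
    and diff_closed: "x \<in> carrier A \<Longrightarrow> diff A x \<in> carrier A"
    and diff_hom_part: "a \<in> hom_part A i \<Longrightarrow> diff A a \<in> hom_part A (i + 1)"
    and diff_diff: "x \<in> carrier A \<Longrightarrow> diff A (diff A x) = \<zero>\<^bsub>A\<^esub>"
    and diff_mult:
      "\<lbrakk>a \<in> hom_part A i; b \<in> hom_part A j\<rbrakk>
        \<Longrightarrow> diff A (a \<otimes>\<^bsub>A\<^esub> b) = (diff A a \<otimes>\<^bsub>A\<^esub> b) \<oplus>\<^bsub>A\<^esub> signed A i (a \<otimes>\<^bsub>A\<^esub> diff A b)"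

definition graded_subset :: "'a set \<Rightarrow> ('k, 'a, 'n) dg_struct_scheme \<Rightarrow> bool" where
  "graded_subset I A \<longleftrightarrow> (\<forall>x\<in>I. \<exists>f. decomposes A (\<lambda>n. I \<inter> hom_part A n) f x)"

definition diff_stable :: "'a set \<Rightarrow> ('k, 'a, 'n) dg_struct_scheme \<Rightarrow> bool" where
  "diff_stable I A \<longleftrightarrow> (\<forall>x\<in>I. diff A x \<in> I)"

text \<open>Ideals are automatically \<open>K\<close>-submodules because \<open>A\<close> is unital.\<close>

definition dg_left_ideal :: "'a set \<Rightarrow> ('k, 'a, 'n) dg_struct_scheme \<Rightarrow> bool" where
  "dg_left_ideal I A \<longleftrightarrow> additive_subgroup I A \<and>
     (\<forall>a\<in>carrier A. \<forall>x\<in>I. a \<otimes>\<^bsub>A\<^esub> x \<in> I) \<and> graded_subset I A \<and> diff_stable I A"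

definition dg_right_ideal :: "'a set \<Rightarrow> ('k, 'a, 'n) dg_struct_scheme \<Rightarrow> bool" where
  "dg_right_ideal I A \<longleftrightarrow> additive_subgroup I A \<and>
     (\<forall>a\<in>carrier A. \<forall>x\<in>I. x \<otimes>\<^bsub>A\<^esub> a \<in> I) \<and> graded_subset I A \<and> diff_stable I A"

definition dg_ideal :: "'a set \<Rightarrow> ('k, 'a, 'n) dg_struct_scheme \<Rightarrow> bool" where
  "dg_ideal I A \<longleftrightarrow> ideal I A \<and> graded_subset I A \<and> diff_stable I A"

text \<open>The zero algebra is not excluded from being dg-simple or a dg-division algebra.\<close>

locale dg_simple_algebra = dg_algebra K A
  for K :: "('k, 'm) ring_scheme" and A :: "('k, 'a, 'n) dg_struct_scheme" +
  assumes dg_ideal_trivial: "dg_ideal I A \<Longrightarrow> I = {\<zero>\<^bsub>A\<^esub>} \<or> I = carrier A"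

locale dg_division_algebra = dg_algebra K A
  for K :: "('k, 'm) ring_scheme" and A :: "('k, 'a, 'n) dg_struct_scheme" +
  assumes dg_left_ideal_trivial: "dg_left_ideal I A \<Longrightarrow> I = {\<zero>\<^bsub>A\<^esub>} \<or> I = carrier A"
    and dg_right_ideal_trivial: "dg_right_ideal I A \<Longrightarrow> I = {\<zero>\<^bsub>A\<^esub>} \<or> I = carrier A"

definition graded_centre_part :: "('k, 'a, 'n) dg_struct_scheme \<Rightarrow> int \<Rightarrow> 'a set" where
  "graded_centre_part A n =
     {b \<in> hom_part A n. \<forall>m. \<forall>a\<in>hom_part A m. b \<otimes>\<^bsub>A\<^esub> a = signed A (m * n) (a \<otimes>\<^bsub>A\<^esub> b)}"

text \<open>All operations, including the differential, are those of \<open>A\<close>; only the carrier and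
  its homogeneous parts shrink.\<close>

definition graded_centre ::
    "('k, 'a, 'n) dg_struct_scheme \<Rightarrow> ('k, 'a, 'n) dg_struct_scheme" where
  "graded_centre A =
     A\<lparr>carrier := {x. \<exists>f. decomposes A (graded_centre_part A) f x},
       hom_part := graded_centre_part A\<rparr>"

end

theory Submission
  imports Defs
begin

text \<open>A nonzero dg-ideal \<open>I\<close> of the graded centre contains a nonzero homogeneous element \<open>z\<close>,
  and one may take \<open>d z = 0\<close>: otherwise replace \<open>z\<close> by the cycle \<open>d z\<close>, which again lies in
  \<open>I\<close>. For a graded central cycle \<open>z\<close> the set \<open>z A\<close> is a twosided dg-ideal of \<open>A\<close>, so it is all
  of \<open>A\<close> and \<open>z\<close> is invertible. The homogeneous component of the inverse is itself graded
  central, hence \<open>1 \<in> I\<close>.\<close>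

section \<open>Signs and graded families\<close>

context ring
begin

lemma signed_closed [simp, intro]: "x \<in> carrier R \<Longrightarrow> signed R n x \<in> carrier R"
  by (simp add: signed_def)

lemma signed_cong: "even i = even j \<Longrightarrow> signed R i x = signed R j x"
  by (simp add: signed_def)

lemma signed_signed: "x \<in> carrier R \<Longrightarrow> signed R i (signed R j x) = signed R (i + j) x"
  by (simp add: signed_def)

lemma signed_add:
  "\<lbrakk>x \<in> carrier R; y \<in> carrier R\<rbrakk> \<Longrightarrow> signed R n (x \<oplus> y) = signed R n x \<oplus> signed R n y"
  by (simp add: signed_def minus_add)

lemma signed_mult_right:
  "\<lbrakk>x \<in> carrier R; y \<in> carrier R\<rbrakk> \<Longrightarrow> x \<otimes> signed R n y = signed R n (x \<otimes> y)"
  by (simp add: signed_def r_minus)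

lemma signed_mult_left:
  "\<lbrakk>x \<in> carrier R; y \<in> carrier R\<rbrakk> \<Longrightarrow> signed R n x \<otimes> y = signed R n (x \<otimes> y)"
  by (simp add: signed_def l_minus)

end

section \<open>Sums of finitely supported families in an abelian group\<close>

context abelian_group
begin

text \<open>Terms outside the support vanish, so the sum may be taken over any finite superset
  \<open>F\<close>. This allows families with different supports to be compared over a common index
  set.\<close>

lemma decomposes_finsum:
  assumes "\<And>n. f n \<in> C n" "\<And>n. C n \<subseteq> carrier G" "finite F" "{n. f n \<noteq> \<zero>} \<subseteq> F"
  shows "decomposes G C f (finsum G f F)"
proof -
  have "finsum G f {n. f n \<noteq> \<zero>} = finsum G f F"
    using assms by (intro add.finprod_mono_neutral_cong_left) auto
  then show ?thesis
    using assms by (auto simp: decomposes_def intro: finite_subset)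
qed

lemma decomposes_zero:
  assumes "\<And>n. \<zero> \<in> C n"
  shows "\<exists>f. decomposes G C f \<zero>"
  by (rule exI[of _ "\<lambda>_. \<zero>"]) (simp add: decomposes_def assms)

lemma decomposes_homogeneous:
  assumes "\<And>n. \<zero> \<in> C n" "\<And>n. C n \<subseteq> carrier G" "x \<in> C i"
  shows "decomposes G C (\<lambda>n. if n = i then x else \<zero>) x"
proof -
  let ?f = "\<lambda>n. if n = i then x else \<zero>"
  have "decomposes G C ?f (finsum G ?f {i})"
    using assms by (intro decomposes_finsum) auto
  moreover have "finsum G ?f {i} = x"
    using subsetD[OF assms(2,3)] by (simp add: finsum_insert)
  ultimately show ?thesis by simp
qed

text \<open>The support of the sum can be smaller than the union of the two supports because of
  cancellation, so everything is summed over the union. The family \<open>C\<close> is left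
  arbitrary: it will stand for the parts of the graded centre, for those of an ideal, and for
  \<open>hom_part A\<close> with degree 0 removed.\<close>

lemma decomposes_add:
  assumes C: "\<And>n. C n \<subseteq> carrier G" "\<And>n x y. \<lbrakk>x \<in> C n; y \<in> C n\<rbrakk> \<Longrightarrow> x \<oplus> y \<in> C n"
    and x: "decomposes G C f x" and y: "decomposes G C g y"
  shows "decomposes G C (\<lambda>n. f n \<oplus> g n) (x \<oplus> y)"
proof -
  let ?F = "{n. f n \<noteq> \<zero>} \<union> {n. g n \<noteq> \<zero>}"
  have fg: "\<And>n. f n \<in> C n" "\<And>n. g n \<in> C n" and fin: "finite ?F"
    using x y by (auto simp: decomposes_def)
  then have cl: "f \<in> ?F \<rightarrow> carrier G" "g \<in> ?F \<rightarrow> carrier G"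
    using C(1) by blast+
  have "x = finsum G f ?F" "y = finsum G g ?F"
    using decomposes_finsum[of f C ?F] decomposes_finsum[of g C ?F] fg fin C(1) x y
    by (auto simp: decomposes_def)
  then have "x \<oplus> y = (\<Oplus>n\<in>?F. f n \<oplus> g n)"
    using cl by (simp add: finsum_addf)
  moreover have "decomposes G C (\<lambda>n. f n \<oplus> g n) (\<Oplus>n\<in>?F. f n \<oplus> g n)"
  proof (intro decomposes_finsum fin)
    show "f n \<oplus> g n \<in> C n" for n using fg C(2) by blast
  qed (use C(1) in auto)
  ultimately show ?thesis by simp
qed

text \<open>Additive statements need only be checked on homogeneous elements, by induction over the
  finite support. The \<open>add\<close> case offers only membership in the carrier; any finer
  closure property has to be carried by \<open>P\<close> itself.\<close>

lemma decomposes_induct [consumes 2, case_names zero homogeneous add]: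
  assumes x: "decomposes G C f x"
    and C: "\<And>n. C n \<subseteq> carrier G"
    and zero: "P \<zero>"
    and homogeneous: "\<And>n x. x \<in> C n \<Longrightarrow> P x"
    and add: "\<And>x y. \<lbrakk>x \<in> carrier G; y \<in> carrier G; P x; P y\<rbrakk> \<Longrightarrow> P (x \<oplus> y)"
  shows "P x"
proof -
  have f: "\<And>n. f n \<in> C n" using x by (simp add: decomposes_def)
  have "P (finsum G f F)" if "finite F" for F
    using that
  proof induction
    case (insert n F)
    have "f \<in> insert n F \<rightarrow> carrier G" using f C by blast
    then show ?case
      using insert f by (auto simp: Pi_iff intro!: add homogeneous[OF f] finsum_closed)
  qed (simp add: zero)
  then show ?thesis using x by (simp add: decomposes_def)
qed

lemma decomposes_closed:
  assumes "decomposes G C f x" and C: "\<And>n. C n \<subseteq> carrier G"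
  shows "x \<in> carrier G"
  using assms by (induction rule: decomposes_induct) (auto dest: subsetD[OF C])

end

section \<open>The graded centre as a dg-algebra\<close>

context dg_algebra
begin

section \<open>Homogeneous parts of the algebra and additivity of the differential\<close>

lemma hom_part_subset: "hom_part A n \<subseteq> carrier A"
  using subgroup.subset[OF submodule.axioms(1)[OF hom_part_submodule[of n]]] by simp

lemma hom_part_closed: "x \<in> hom_part A n \<Longrightarrow> x \<in> carrier A"
  using hom_part_subset by blast

lemma zero_hom_part: "\<zero>\<^bsub>A\<^esub> \<in> hom_part A n"
  using subgroup.one_closed[OF submodule.axioms(1)[OF hom_part_submodule[of n]]] by simp

lemma add_hom_part: "\<lbrakk>x \<in> hom_part A n; y \<in> hom_part A n\<rbrakk> \<Longrightarrow> x \<oplus>\<^bsub>A\<^esub> y \<in> hom_part A n"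
  using subgroup.m_closed[OF submodule.axioms(1)[OF hom_part_submodule[of n]]] by simp

lemma minus_hom_part: "x \<in> hom_part A n \<Longrightarrow> \<ominus>\<^bsub>A\<^esub> x \<in> hom_part A n"
  using subgroup.m_inv_closed[OF submodule.axioms(1)[OF hom_part_submodule[of n]]]
  by (simp add: a_inv_def)

lemma smult_hom_part:
  "\<lbrakk>k \<in> carrier K; x \<in> hom_part A n\<rbrakk> \<Longrightarrow> k \<odot>\<^bsub>A\<^esub> x \<in> hom_part A n"
  using submodule.smult_closed[OF hom_part_submodule] .

lemma hom_part_induct [consumes 1, case_names zero homogeneous add]:
  assumes "x \<in> carrier A"
    and "P \<zero>\<^bsub>A\<^esub>"
    and "\<And>n x. x \<in> hom_part A n \<Longrightarrow> P x"
    and "\<And>x y. \<lbrakk>x \<in> carrier A; y \<in> carrier A; P x; P y\<rbrakk> \<Longrightarrow> P (x \<oplus>\<^bsub>A\<^esub> y)"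
  shows "P x"
proof -
  obtain f where "decomposes A (hom_part A) f x"
    using hom_part_direct_sum[OF assms(1)] by blast
  then show ?thesis
    using hom_part_subset assms(2-) by (rule decomposes_induct)
qed

lemma diff_zero: "diff A \<zero>\<^bsub>A\<^esub> = \<zero>\<^bsub>A\<^esub>"
  using diff_add[of "\<zero>\<^bsub>A\<^esub>" "\<zero>\<^bsub>A\<^esub>"] diff_closed[of "\<zero>\<^bsub>A\<^esub>"]
  by (metis add.l_cancel_one' l_zero zero_closed)

lemma diff_minus: "x \<in> carrier A \<Longrightarrow> diff A (\<ominus>\<^bsub>A\<^esub> x) = \<ominus>\<^bsub>A\<^esub> diff A x"
  using diff_add[of "\<ominus>\<^bsub>A\<^esub> x" x] diff_closed
  by (metis a_inv_closed diff_zero l_neg minus_equality)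

lemma diff_signed: "x \<in> carrier A \<Longrightarrow> diff A (signed A n x) = signed A n (diff A x)"
  by (simp add: signed_def diff_minus)

section \<open>Homogeneous elements of the graded centre\<close>

abbreviation Z where "Z \<equiv> graded_centre_part A"

lemma centre_hom_part: "b \<in> Z n \<Longrightarrow> b \<in> hom_part A n"
  by (simp add: graded_centre_part_def)

lemma centre_subset: "Z n \<subseteq> carrier A"
  using centre_hom_part hom_part_closed by blast

lemma centre_closed: "b \<in> Z n \<Longrightarrow> b \<in> carrier A"
  using centre_subset by blast

lemma centre_commute:
  "\<lbrakk>b \<in> Z n; a \<in> hom_part A m\<rbrakk> \<Longrightarrow> b \<otimes>\<^bsub>A\<^esub> a = signed A (m * n) (a \<otimes>\<^bsub>A\<^esub> b)"
  by (simp add: graded_centre_part_def)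

text \<open>The sign is its own inverse, so the commutation rule can be read in either
  direction.\<close>

lemma centre_commute':
  assumes "b \<in> Z n" "a \<in> hom_part A m"
  shows "a \<otimes>\<^bsub>A\<^esub> b = signed A (m * n) (b \<otimes>\<^bsub>A\<^esub> a)"
proof -
  have "signed A (m * n) (b \<otimes>\<^bsub>A\<^esub> a) = signed A (m * n + m * n) (a \<otimes>\<^bsub>A\<^esub> b)"
    using assms centre_closed hom_part_closed by (simp add: centre_commute signed_signed)
  then show ?thesis by (simp add: signed_def)
qed

lemma centreI:
  "\<lbrakk>b \<in> hom_part A n; \<And>m a. a \<in> hom_part A m \<Longrightarrow> b \<otimes>\<^bsub>A\<^esub> a = signed A (m * n) (a \<otimes>\<^bsub>A\<^esub> b)\<rbrakk>
    \<Longrightarrow> b \<in> Z n"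
  by (simp add: graded_centre_part_def)

lemma zero_centre: "\<zero>\<^bsub>A\<^esub> \<in> Z n"
  by (rule centreI) (auto simp: zero_hom_part signed_def hom_part_closed)

lemma one_centre: "\<one>\<^bsub>A\<^esub> \<in> Z 0"
  by (rule centreI) (auto simp: one_hom_part signed_def hom_part_closed)

lemma add_centre:
  assumes "b \<in> Z n" "c \<in> Z n"
  shows "b \<oplus>\<^bsub>A\<^esub> c \<in> Z n"
proof (rule centreI)
  fix m a assume a: "a \<in> hom_part A m"
  note cl = centre_closed[OF assms(1)] centre_closed[OF assms(2)] hom_part_closed[OF a]
  show "(b \<oplus>\<^bsub>A\<^esub> c) \<otimes>\<^bsub>A\<^esub> a = signed A (m * n) (a \<otimes>\<^bsub>A\<^esub> (b \<oplus>\<^bsub>A\<^esub> c))"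
    using cl by (simp add: l_distr r_distr signed_add assms[THEN centre_commute, OF a])
qed (use assms in \<open>auto intro: add_hom_part centre_hom_part\<close>)

lemma smult_centre:
  assumes k: "k \<in> carrier K" and b: "b \<in> Z n"
  shows "k \<odot>\<^bsub>A\<^esub> b \<in> Z n"
proof (rule centreI)
  fix m a assume a: "a \<in> hom_part A m"
  note cl = centre_closed[OF b] hom_part_closed[OF a]
  have "k \<odot>\<^bsub>A\<^esub> signed A (m * n) (a \<otimes>\<^bsub>A\<^esub> b) = signed A (m * n) (k \<odot>\<^bsub>A\<^esub> (a \<otimes>\<^bsub>A\<^esub> b))"
    using k cl by (simp add: signed_def smult_r_minus)
  then show "(k \<odot>\<^bsub>A\<^esub> b) \<otimes>\<^bsub>A\<^esub> a = signed A (m * n) (a \<otimes>\<^bsub>A\<^esub> (k \<odot>\<^bsub>A\<^esub> b))"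
    using k cl by (simp add: smult_mult_left smult_mult_right centre_commute[OF b a])
qed (use assms in \<open>auto intro: smult_hom_part centre_hom_part\<close>)

lemma minus_centre:
  assumes b: "b \<in> Z n"
  shows "\<ominus>\<^bsub>A\<^esub> b \<in> Z n"
proof (rule centreI)
  fix m a assume a: "a \<in> hom_part A m"
  note cl = centre_closed[OF b] hom_part_closed[OF a]
  show "(\<ominus>\<^bsub>A\<^esub> b) \<otimes>\<^bsub>A\<^esub> a = signed A (m * n) (a \<otimes>\<^bsub>A\<^esub> (\<ominus>\<^bsub>A\<^esub> b))"
    using cl by (simp add: l_minus r_minus centre_commute[OF b a]) (simp add: signed_def)
qed (use b in \<open>auto intro: minus_hom_part centre_hom_part\<close>)

text \<open>Moving \<open>a\<close> first past \<open>c\<close> and then past \<open>b\<close>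
  produces the exponents \<open>m * j\<close> and \<open>m * i\<close>, which add up to
  \<open>m * (i + j)\<close>.\<close>

lemma mult_centre:
  assumes b: "b \<in> Z i" and c: "c \<in> Z j"
  shows "b \<otimes>\<^bsub>A\<^esub> c \<in> Z (i + j)"
proof (rule centreI)
  fix m a assume a: "a \<in> hom_part A m"
  note cl = centre_closed[OF b] centre_closed[OF c] hom_part_closed[OF a]
  have "(b \<otimes>\<^bsub>A\<^esub> c) \<otimes>\<^bsub>A\<^esub> a = signed A (m * j) ((b \<otimes>\<^bsub>A\<^esub> a) \<otimes>\<^bsub>A\<^esub> c)"
    using cl by (simp add: m_assoc centre_commute[OF c a] signed_mult_right)
  also have "\<dots> = signed A (m * (i + j)) (a \<otimes>\<^bsub>A\<^esub> (b \<otimes>\<^bsub>A\<^esub> c))"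
    using cl by (simp add: m_assoc centre_commute[OF b a] signed_mult_left signed_signed
        algebra_simps)
  finally show "(b \<otimes>\<^bsub>A\<^esub> c) \<otimes>\<^bsub>A\<^esub> a = signed A (m * (i + j)) (a \<otimes>\<^bsub>A\<^esub> (b \<otimes>\<^bsub>A\<^esub> c))" .
qed (use assms in \<open>auto intro: mult_hom_part centre_hom_part\<close>)

text \<open>The differential is applied to both sides of the commutation rule for \<open>b\<close>
  and \<open>a\<close>. By the Leibniz rule each side has one term containing
  \<open>diff A a\<close>; these two agree and cancel, and what remains is the commutation rule for
  \<open>diff A b\<close>.\<close>

lemma diff_centre:
  assumes b: "b \<in> Z i"
  shows "diff A b \<in> Z (i + 1)"
proof (rule centreI)
  fix m a assume a: "a \<in> hom_part A m"
  note cl = centre_closed[OF b] hom_part_closed[OF a]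
  note dcl = cl[THEN diff_closed]
  let ?w = "signed A (m * i) (diff A a \<otimes>\<^bsub>A\<^esub> b)"
  have "diff A (b \<otimes>\<^bsub>A\<^esub> a) = diff A b \<otimes>\<^bsub>A\<^esub> a \<oplus>\<^bsub>A\<^esub> signed A i (b \<otimes>\<^bsub>A\<^esub> diff A a)"
    using diff_mult[OF centre_hom_part[OF b] a] .
  \<comment> \<open>Since \<open>diff A a\<close> has degree \<open>m + 1\<close>, commuting it with
    \<open>b\<close> gives the exponent \<open>(m + 1) * i\<close>; together with the Leibniz sign
    \<open>i\<close> this has the parity of \<open>m * i\<close>.\<close>
  also have "signed A i (b \<otimes>\<^bsub>A\<^esub> diff A a) = ?w"
    using cl dcl centre_commute[OF b diff_hom_part[OF a]]
    by (simp add: signed_signed) (rule signed_cong, auto)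
  finally have l: "diff A (b \<otimes>\<^bsub>A\<^esub> a) = diff A b \<otimes>\<^bsub>A\<^esub> a \<oplus>\<^bsub>A\<^esub> ?w" .
  have "diff A (b \<otimes>\<^bsub>A\<^esub> a) = signed A (m * i) (diff A (a \<otimes>\<^bsub>A\<^esub> b))"
    using cl by (simp add: centre_commute[OF b a] diff_signed)
  \<comment> \<open>The Leibniz sign is now that of \<open>a\<close>, so the second exponent is
    \<open>m * i + m\<close>.\<close>
  also have "\<dots> = ?w \<oplus>\<^bsub>A\<^esub> signed A (m * (i + 1)) (a \<otimes>\<^bsub>A\<^esub> diff A b)"
    using cl dcl
    by (simp add: diff_mult[OF a centre_hom_part[OF b]] signed_add signed_signed algebra_simps)
  also have "\<dots> = signed A (m * (i + 1)) (a \<otimes>\<^bsub>A\<^esub> diff A b) \<oplus>\<^bsub>A\<^esub> ?w"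
    using cl dcl by (intro a_comm) auto
  finally show "diff A b \<otimes>\<^bsub>A\<^esub> a = signed A (m * (i + 1)) (a \<otimes>\<^bsub>A\<^esub> diff A b)"
    using cl dcl l by (metis add.r_cancel m_closed signed_closed)
qed (use b in \<open>auto intro: diff_hom_part centre_hom_part\<close>)

section \<open>Closure properties of the whole graded centre\<close>

abbreviation ZA where "ZA \<equiv> carrier (graded_centre A)"

lemma graded_centre_simps [simp]:
  "hom_part (graded_centre A) = Z" "\<zero>\<^bsub>graded_centre A\<^esub> = \<zero>\<^bsub>A\<^esub>"
  "\<one>\<^bsub>graded_centre A\<^esub> = \<one>\<^bsub>A\<^esub>" "x \<oplus>\<^bsub>graded_centre A\<^esub> y = x \<oplus>\<^bsub>A\<^esub> y"
  "x \<otimes>\<^bsub>graded_centre A\<^esub> y = x \<otimes>\<^bsub>A\<^esub> y" "k \<odot>\<^bsub>graded_centre A\<^esub> x = k \<odot>\<^bsub>A\<^esub> x"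
  "diff (graded_centre A) = diff A"
  by (simp_all add: graded_centre_def)

lemma carrier_graded_centre: "ZA = {x. \<exists>f. decomposes A Z f x}"
  by (simp add: graded_centre_def)

lemma ZA_homogeneous: "x \<in> Z n \<Longrightarrow> x \<in> ZA"
  using decomposes_homogeneous[of Z, OF zero_centre centre_subset] by (auto simp: carrier_graded_centre)

lemma ZA_add: "\<lbrakk>x \<in> ZA; y \<in> ZA\<rbrakk> \<Longrightarrow> x \<oplus>\<^bsub>A\<^esub> y \<in> ZA"
  using decomposes_add[of Z, OF centre_subset add_centre] by (fastforce simp: carrier_graded_centre)

lemma ZA_closed: "x \<in> ZA \<Longrightarrow> x \<in> carrier A"
  using decomposes_closed[of Z, OF _ centre_subset] by (auto simp: carrier_graded_centre)

text \<open>Zero needs no case of its own, because it lies in every \<open>Z n\<close>.\<close>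

lemma ZA_induct [consumes 1, case_names homogeneous add]:
  assumes x: "x \<in> ZA"
    and hom: "\<And>n x. x \<in> Z n \<Longrightarrow> P x"
    and add: "\<And>x y. \<lbrakk>x \<in> carrier A; y \<in> carrier A; P x; P y\<rbrakk> \<Longrightarrow> P (x \<oplus>\<^bsub>A\<^esub> y)"
  shows "P x"
proof -
  obtain f where "decomposes A Z f x" using x by (auto simp: carrier_graded_centre)
  then show ?thesis
    using centre_subset hom[OF zero_centre] hom add by (rule decomposes_induct)
qed

lemma ZA_zero: "\<zero>\<^bsub>A\<^esub> \<in> ZA"
  using ZA_homogeneous zero_centre .

lemma ZA_minus: "x \<in> ZA \<Longrightarrow> \<ominus>\<^bsub>A\<^esub> x \<in> ZA"
  by (induction rule: ZA_induct) (auto simp: minus_add intro: ZA_homogeneous minus_centre ZA_add)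

lemma ZA_smult: "\<lbrakk>x \<in> ZA; k \<in> carrier K\<rbrakk> \<Longrightarrow> k \<odot>\<^bsub>A\<^esub> x \<in> ZA"
  by (induction rule: ZA_induct)
    (auto simp: smult_r_distr intro: ZA_homogeneous smult_centre ZA_add)

lemma ZA_diff: "x \<in> ZA \<Longrightarrow> diff A x \<in> ZA"
  by (induction rule: ZA_induct) (auto simp: diff_add intro: ZA_homogeneous diff_centre ZA_add)

text \<open>Multiplication is biadditive, so splitting first \<open>x\<close> and then
  \<open>y\<close> into homogeneous elements reduces the claim to
  \<open>mult_centre\<close>.\<close>

lemma ZA_mult:
  assumes x: "x \<in> ZA" and y: "y \<in> ZA"
  shows "x \<otimes>\<^bsub>A\<^esub> y \<in> ZA"
  using x
proof (induction rule: ZA_induct)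
  case (homogeneous n x)
  show ?case
    using y
  proof (induction rule: ZA_induct)
    case (homogeneous m y)
    then show ?case using \<open>x \<in> Z n\<close> by (blast intro: ZA_homogeneous mult_centre)
  next
    case (add y y')
    then show ?case using centre_closed[OF \<open>x \<in> Z n\<close>] by (simp add: r_distr ZA_add)
  qed
next
  case (add x x')
  then show ?case using ZA_closed[OF y] by (simp add: l_distr ZA_add)
qed

section \<open>Transfer of the dg-algebra structure to the graded centre\<close>

lemma ring_graded_centre: "ring (graded_centre A)"
proof (intro ringI abelian_groupI monoidI)
  fix x assume "x \<in> ZA"
  then show "\<exists>y\<in>ZA. y \<oplus>\<^bsub>graded_centre A\<^esub> x = \<zero>\<^bsub>graded_centre A\<^esub>"
    by (intro bexI[of _ "\<ominus>\<^bsub>A\<^esub> x"]) (auto simp: l_neg ZA_closed ZA_minus)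
qed (auto simp: ZA_add ZA_mult ZA_zero ZA_homogeneous[OF one_centre] a_assoc m_assoc l_distr
    r_distr ZA_closed intro: a_comm)

text \<open>Negation is not a record field but is defined through the carrier, so shrinking the
  carrier might change it. Uniqueness of additive inverses in the smaller ring shows that it does
  not.\<close>

lemma minus_graded_centre:
  assumes "x \<in> ZA"
  shows "\<ominus>\<^bsub>graded_centre A\<^esub> x = \<ominus>\<^bsub>A\<^esub> x"
proof -
  interpret C: ring "graded_centre A" by (rule ring_graded_centre)
  show ?thesis
    using assms by (intro C.minus_equality) (auto simp: l_neg ZA_closed ZA_minus)
qed

lemma signed_graded_centre: "x \<in> ZA \<Longrightarrow> signed (graded_centre A) n x = signed A n x"
  by (simp add: signed_def minus_graded_centre)

text \<open>\<open>finsum\<close> also refers to the carrier; the two sums are built up by the same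
  additions as long as all terms lie in \<open>ZA\<close>.\<close>

lemma finsum_graded_centre:
  assumes "finite F" "f \<in> F \<rightarrow> ZA"
  shows "finsum (graded_centre A) f F = finsum A f F"
proof -
  interpret C: ring "graded_centre A" by (rule ring_graded_centre)
  show ?thesis
    using assms
  proof (induction F)
    case (insert n F)
    then have "f \<in> F \<rightarrow> carrier A" "f n \<in> carrier A" using ZA_closed by auto
    then show ?case using insert by simp
  qed simp
qed

lemma decomposes_graded_centre:
  assumes "\<And>n. C n \<subseteq> ZA"
  shows "decomposes (graded_centre A) C f x \<longleftrightarrow> decomposes A C f x"
proof -
  have "finsum (graded_centre A) f {n. f n \<noteq> \<zero>\<^bsub>A\<^esub>} = finsum A f {n. f n \<noteq> \<zero>\<^bsub>A\<^esub>}"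
    if "\<forall>n. f n \<in> C n" "finite {n. f n \<noteq> \<zero>\<^bsub>A\<^esub>}"
    using that assms by (intro finsum_graded_centre) auto
  then show ?thesis by (auto simp: decomposes_def)
qed

lemma dg_algebra_graded_centre: "dg_algebra K (graded_centre A)"
proof -
  interpret C: ring "graded_centre A" by (rule ring_graded_centre)
  have module: "module K (graded_centre A)"
    by (intro moduleI module.axioms(1)[OF module_axioms] C.abelian_group_axioms)
      (auto simp: ZA_smult ZA_closed smult_l_distr smult_r_distr smult_assoc1)
  show ?thesis
  proof (intro dg_algebra.intro dg_algebra_axioms.intro module ring_graded_centre)
    fix n
    show "submodule (hom_part (graded_centre A) n) K (graded_centre A)"
    proof (intro submodule.intro submodule_axioms.intro subgroup.intro)
      fix x assume "x \<in> hom_part (graded_centre A) n"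
      then show "inv\<^bsub>add_monoid (graded_centre A)\<^esub> x \<in> hom_part (graded_centre A) n"
        unfolding a_inv_def[symmetric] by (simp add: minus_graded_centre ZA_homogeneous minus_centre)
    qed (auto simp: ZA_homogeneous zero_centre add_centre smult_centre)
  next
    fix x assume x: "x \<in> ZA"
    then obtain f where f: "decomposes A Z f x" by (auto simp: carrier_graded_centre)
    \<comment> \<open>Existence of a decomposition is the definition of the carrier. Uniqueness is
      inherited: a decomposition into central parts is in particular one into the homogeneous parts
      of \<open>A\<close>.\<close>
    have unique: "\<And>g. decomposes A Z g x \<Longrightarrow> decomposes A (hom_part A) g x"
      using centre_hom_part by (auto simp: decomposes_def)
    show "\<exists>!f. decomposes (graded_centre A) (hom_part (graded_centre A)) f x"
      using f unique hom_part_direct_sum[OF ZA_closed[OF x]]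
      by (subst graded_centre_simps, subst decomposes_graded_centre) (auto intro: ZA_homogeneous)
  next
    fix a b i j
    assume "a \<in> hom_part (graded_centre A) i" "b \<in> hom_part (graded_centre A) j"
    then have ab: "a \<in> Z i" "b \<in> Z j" by simp_all
    \<comment> \<open>The sign in the Leibniz rule uses the negation of the graded centre, which is
      known to agree with that of \<open>A\<close> only on \<open>ZA\<close>.\<close>
    have "a \<otimes>\<^bsub>A\<^esub> diff A b \<in> ZA"
      using ab by (intro ZA_mult ZA_diff ZA_homogeneous)
    then show "diff (graded_centre A) (a \<otimes>\<^bsub>graded_centre A\<^esub> b) =
        diff (graded_centre A) a \<otimes>\<^bsub>graded_centre A\<^esub> b \<oplus>\<^bsub>graded_centre A\<^esub>
        signed (graded_centre A) i (a \<otimes>\<^bsub>graded_centre A\<^esub> diff (graded_centre A) b)"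
      using diff_mult[OF ab[THEN centre_hom_part]] by (simp add: signed_graded_centre)
  qed (auto simp: smult_mult_left smult_mult_right ZA_closed one_centre mult_centre diff_add
      diff_smult ZA_diff diff_centre diff_diff)
qed

section \<open>Invertibility of graded central cycles\<close>

text \<open>In a direct sum, degree 0 meets the sum of all other degrees only in zero. That
  complementary sum is encoded by replacing the part of degree 0 by the zero group.\<close>

lemma hom_part_zero_complement:
  assumes x: "x \<in> hom_part A 0"
    and f: "decomposes A (\<lambda>n. if n = 0 then {\<zero>\<^bsub>A\<^esub>} else hom_part A n) f x"
  shows "x = \<zero>\<^bsub>A\<^esub>"
proof -
  let ?C = "\<lambda>n. if n = 0 then {\<zero>\<^bsub>A\<^esub>} else hom_part A n"
  have *: "\<And>n. f n \<in> ?C n" using f by (simp add: decomposes_def)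
  have "\<And>n. f n \<in> hom_part A n"
  proof -
    fix n show "f n \<in> hom_part A n" using *[of n] zero_hom_part by (cases "n = 0") auto
  qed
  then have "decomposes A (hom_part A) f x" using f by (simp add: decomposes_def)
  moreover have "decomposes A (hom_part A) (\<lambda>n. if n = 0 then x else \<zero>\<^bsub>A\<^esub>) x"
    using x by (intro decomposes_homogeneous zero_hom_part hom_part_subset)
  ultimately have "f = (\<lambda>n. if n = 0 then x else \<zero>\<^bsub>A\<^esub>)"
    using hom_part_direct_sum[OF hom_part_closed[OF x]] by blast
  \<comment> \<open>At index 0 one decomposition has the entry \<open>x\<close> and the other has
    zero.\<close>
  with *[of 0] show ?thesis by simp
qed

text \<open>Only the component of \<open>a\<close> in degree \<open>- n\<close> contributes to
  degree 0 of the product, and 1 is of degree 0. Instead of projecting onto components, the product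
  is written as \<open>z\<close> times an element of degree \<open>- n\<close> plus a remainder
  \<open>r\<close> without part in degree 0, and \<open>r\<close> is shown to vanish.\<close>

lemma homogeneous_right_inverse:
  assumes z: "z \<in> hom_part A n" and a: "a \<in> carrier A" and za: "z \<otimes>\<^bsub>A\<^esub> a = \<one>\<^bsub>A\<^esub>"
  obtains a' where "a' \<in> hom_part A (- n)" "z \<otimes>\<^bsub>A\<^esub> a' = \<one>\<^bsub>A\<^esub>"
proof -
  note zc = hom_part_closed[OF z]
  let ?C = "\<lambda>n. if n = 0 then {\<zero>\<^bsub>A\<^esub>} else hom_part A n"
  have C: "\<And>n. \<zero>\<^bsub>A\<^esub> \<in> ?C n" "\<And>n. ?C n \<subseteq> carrier A"
    "\<And>n x y. \<lbrakk>x \<in> ?C n; y \<in> ?C n\<rbrakk> \<Longrightarrow> x \<oplus>\<^bsub>A\<^esub> y \<in> ?C n"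
    using hom_part_closed zero_hom_part add_hom_part by (auto split: if_splits)
  let ?S = "{x. \<exists>f. decomposes A ?C f x}"
  have S: "x \<in> carrier A" if "x \<in> ?S" for x
    using that decomposes_closed[of ?C, OF _ C(2)] by blast
  \<comment> \<open>This form of the splitting is additive in \<open>a\<close>, so it can be proved
    by induction over homogeneous summands: those of degree \<open>- n\<close> go into
    \<open>a'\<close>, all others into \<open>r\<close>.\<close>
  have "\<exists>a'\<in>hom_part A (- n). \<exists>r\<in>?S. z \<otimes>\<^bsub>A\<^esub> a = z \<otimes>\<^bsub>A\<^esub> a' \<oplus>\<^bsub>A\<^esub> r"
    using a
  proof (induction rule: hom_part_induct)
    case zero
    show ?case
      using zero_hom_part zc decomposes_zero[of ?C, OF C(1)]
      by (intro bexI[of _ "\<zero>\<^bsub>A\<^esub>"]) auto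
  next
    case (homogeneous m x)
    note xc = hom_part_closed[OF homogeneous]
    show ?case
    proof (cases "m = - n")
      case True
      then show ?thesis
        using homogeneous xc zc decomposes_zero[of ?C, OF C(1)]
        by (intro bexI[of _ x] bexI[of _ "\<zero>\<^bsub>A\<^esub>"]) auto
    next
      case False
      then have "z \<otimes>\<^bsub>A\<^esub> x \<in> ?C (n + m)"
        using mult_hom_part[OF z homogeneous] by auto
      from decomposes_homogeneous[of ?C, OF C(1,2) this] show ?thesis
        using xc zc zero_hom_part
        by (intro bexI[of _ "\<zero>\<^bsub>A\<^esub>"] bexI[of _ "z \<otimes>\<^bsub>A\<^esub> x"]) auto
    qed
  next
    case (add x y)
    then obtain x' r y' s where
      x': "x' \<in> hom_part A (- n)" "r \<in> ?S" "z \<otimes>\<^bsub>A\<^esub> x = z \<otimes>\<^bsub>A\<^esub> x' \<oplus>\<^bsub>A\<^esub> r" and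
      y': "y' \<in> hom_part A (- n)" "s \<in> ?S" "z \<otimes>\<^bsub>A\<^esub> y = z \<otimes>\<^bsub>A\<^esub> y' \<oplus>\<^bsub>A\<^esub> s" by blast
    have "r \<oplus>\<^bsub>A\<^esub> s \<in> ?S"
      using x'(2) y'(2) decomposes_add[of ?C, OF C(2,3)] by blast
    moreover have "x' \<oplus>\<^bsub>A\<^esub> y' \<in> hom_part A (- n)"
      using x'(1) y'(1) by (rule add_hom_part)
    moreover have "z \<otimes>\<^bsub>A\<^esub> (x \<oplus>\<^bsub>A\<^esub> y) = z \<otimes>\<^bsub>A\<^esub> (x' \<oplus>\<^bsub>A\<^esub> y') \<oplus>\<^bsub>A\<^esub> (r \<oplus>\<^bsub>A\<^esub> s)"
      using add.hyps zc x' y' hom_part_closed[OF x'(1)] hom_part_closed[OF y'(1)]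
        S[OF x'(2)] S[OF y'(2)]
      by (simp add: r_distr a_ac)
    ultimately show ?case by blast
  qed
  then obtain a' r where a': "a' \<in> hom_part A (- n)" and r: "r \<in> ?S"
    and eq: "\<one>\<^bsub>A\<^esub> = z \<otimes>\<^bsub>A\<^esub> a' \<oplus>\<^bsub>A\<^esub> r"
    using za by auto
  have p: "z \<otimes>\<^bsub>A\<^esub> a' \<in> hom_part A 0" using mult_hom_part[OF z a'] by simp
  note cl = hom_part_closed[OF p] S[OF r]
  \<comment> \<open>As a difference of two elements of degree 0, the remainder itself has degree 0,
    yet it is a sum of elements of other degrees.\<close>
  have "r = \<ominus>\<^bsub>A\<^esub> (z \<otimes>\<^bsub>A\<^esub> a') \<oplus>\<^bsub>A\<^esub> \<one>\<^bsub>A\<^esub>"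
    using cl by (simp add: eq r_neg1)
  then have "r \<in> hom_part A 0"
    using p one_hom_part by (simp add: add_hom_part minus_hom_part)
  with r have "r = \<zero>\<^bsub>A\<^esub>" using hom_part_zero_complement by blast
  with eq cl have "z \<otimes>\<^bsub>A\<^esub> a' = \<one>\<^bsub>A\<^esub>" by simp
  with a' that show ?thesis by blast
qed

text \<open>Multiplying either side of the commutation rule for \<open>a\<close> and
  \<open>x\<close> by \<open>z\<close> from the left yields \<open>x\<close>, and \<open>z\<close>
  can be cancelled because \<open>a\<close> is a left inverse of it up to sign.\<close>

lemma homogeneous_inverse_central:
  assumes z: "z \<in> Z n" and a: "a \<in> hom_part A (- n)" and za: "z \<otimes>\<^bsub>A\<^esub> a = \<one>\<^bsub>A\<^esub>"
  shows "a \<in> Z (- n)"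
proof (rule centreI[OF a])
  fix m x assume x: "x \<in> hom_part A m"
  note cl = centre_closed[OF z] hom_part_closed[OF a] hom_part_closed[OF x]
  \<comment> \<open>The sign has exponent \<open>- n * n\<close>, which has the same parity as
    \<open>n\<close>.\<close>
  have az: "a \<otimes>\<^bsub>A\<^esub> z = signed A n \<one>\<^bsub>A\<^esub>"
    using centre_commute'[OF z a] za by (simp add: signed_def)
  have cancel: "u = v" if "z \<otimes>\<^bsub>A\<^esub> u = z \<otimes>\<^bsub>A\<^esub> v" "u \<in> carrier A" "v \<in> carrier A" for u v
  proof -
    have "signed A n u = signed A n v"
      using arg_cong[OF that(1), of "\<lambda>w. a \<otimes>\<^bsub>A\<^esub> w"] that(2,3) cl
      by (simp add: m_assoc[symmetric] az signed_mult_left)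
    then have "signed A n (signed A n u) = signed A n (signed A n v)" by simp
    then show ?thesis using that(2,3) by (simp add: signed_signed) (simp add: signed_def)
  qed
  have "z \<otimes>\<^bsub>A\<^esub> (a \<otimes>\<^bsub>A\<^esub> x) = x"
    using cl by (simp add: m_assoc[symmetric] za)
  moreover have "z \<otimes>\<^bsub>A\<^esub> signed A (m * - n) (x \<otimes>\<^bsub>A\<^esub> a) = x"
  proof -
    have "z \<otimes>\<^bsub>A\<^esub> signed A (m * - n) (x \<otimes>\<^bsub>A\<^esub> a) = signed A (m * - n) ((z \<otimes>\<^bsub>A\<^esub> x) \<otimes>\<^bsub>A\<^esub> a)"
      using cl by (simp add: signed_mult_right m_assoc)
    \<comment> \<open>Commuting \<open>z\<close> past \<open>x\<close> contributes
      \<open>m * n\<close>, which cancels the exponent already present.\<close>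
    also have "\<dots> = signed A (m * - n + m * n) (x \<otimes>\<^bsub>A\<^esub> (z \<otimes>\<^bsub>A\<^esub> a))"
      using cl by (simp add: centre_commute[OF z x] signed_mult_left signed_signed m_assoc)
    also have "\<dots> = x" using cl za by (simp add: signed_def)
    finally show ?thesis .
  qed
  ultimately have "z \<otimes>\<^bsub>A\<^esub> (a \<otimes>\<^bsub>A\<^esub> x) = z \<otimes>\<^bsub>A\<^esub> signed A (m * - n) (x \<otimes>\<^bsub>A\<^esub> a)"
    by simp
  then show "a \<otimes>\<^bsub>A\<^esub> x = signed A (m * - n) (x \<otimes>\<^bsub>A\<^esub> a)"
    by (rule cancel) (use cl in auto)
qed

text \<open>Centrality of \<open>z\<close> makes the right ideal \<open>z A\<close> twosided,
  homogeneity of \<open>z\<close> makes it graded, and \<open>diff A z\<close> being zero makes it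
  stable under the differential.\<close>

lemma dg_ideal_central_cycle:
  assumes z: "z \<in> Z n" and dz: "diff A z = \<zero>\<^bsub>A\<^esub>"
  shows "dg_ideal ((\<lambda>a. z \<otimes>\<^bsub>A\<^esub> a) ` carrier A) A"
proof -
  note zc = centre_closed[OF z]
  let ?I = "(\<lambda>a. z \<otimes>\<^bsub>A\<^esub> a) ` carrier A"
  have I_add: "x \<oplus>\<^bsub>A\<^esub> y \<in> ?I" if "x \<in> ?I" "y \<in> ?I" for x y
    using that zc by (auto simp: r_distr[symmetric])
  have I_zero: "\<zero>\<^bsub>A\<^esub> \<in> ?I" using zc by (auto intro: image_eqI[of _ _ "\<zero>\<^bsub>A\<^esub>"])
  have I_minus: "\<ominus>\<^bsub>A\<^esub> x \<in> ?I" if "x \<in> ?I" for x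
    using that zc by (auto simp: r_minus[symmetric])
  have I_signed: "signed A m x \<in> ?I" if "x \<in> ?I" for m x
    using that I_minus by (simp add: signed_def)
  have I_right: "x \<otimes>\<^bsub>A\<^esub> b \<in> ?I" if "x \<in> ?I" "b \<in> carrier A" for x b
    using that zc by (auto simp: m_assoc)
  have I_closed: "x \<in> carrier A" if "x \<in> ?I" for x using that zc by auto
  \<comment> \<open>For homogeneous \<open>b\<close> this product is, up to sign, \<open>z\<close>
    times \<open>b\<close>; the general case follows by additivity.\<close>
  have bz: "b \<otimes>\<^bsub>A\<^esub> z \<in> ?I" if "b \<in> carrier A" for b
    using that
  proof (induction rule: hom_part_induct)
    case (homogeneous m x)
    then show ?case using hom_part_closed by (auto simp: centre_commute'[OF z] intro: I_signed)
  qed (auto simp: zc l_distr I_zero intro: I_add)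
  have I_left: "b \<otimes>\<^bsub>A\<^esub> x \<in> ?I" if "x \<in> ?I" "b \<in> carrier A" for x b
    using that zc I_right[OF bz] by (auto simp: m_assoc[symmetric])
  have "additive_subgroup ?I A"
  proof (intro additive_subgroup.intro subgroup.intro)
    fix x assume "x \<in> ?I"
    then show "inv\<^bsub>add_monoid A\<^esub> x \<in> ?I" using I_minus by (simp add: a_inv_def)
  qed (use I_closed I_add I_zero in auto)
  then have "ideal ?I A"
    using I_left I_right additive_subgroup.a_subgroup
    by (intro idealI ring_axioms) auto
  moreover have "diff A (z \<otimes>\<^bsub>A\<^esub> a) \<in> ?I" if "a \<in> carrier A" for a
    using that
  proof (induction rule: hom_part_induct)
    case (homogeneous m x)
    \<comment> \<open>The first Leibniz term vanishes because \<open>z\<close> is a cycle.\<close>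
    then have "diff A (z \<otimes>\<^bsub>A\<^esub> x) = signed A n (z \<otimes>\<^bsub>A\<^esub> diff A x)"
      using zc hom_part_closed diff_closed by (simp add: diff_mult[OF centre_hom_part[OF z]] dz)
    then show ?case using homogeneous hom_part_closed diff_closed by (auto intro: I_signed)
  qed (auto simp: zc diff_zero I_zero r_distr diff_add intro: I_add)
  moreover have "\<exists>f. decomposes A (\<lambda>n. ?I \<inter> hom_part A n) f (z \<otimes>\<^bsub>A\<^esub> a)" if "a \<in> carrier A" for a
  proof -
    let ?C = "\<lambda>n. ?I \<inter> hom_part A n"
    have C: "\<And>n. \<zero>\<^bsub>A\<^esub> \<in> ?C n" "\<And>n. ?C n \<subseteq> carrier A"
      "\<And>n x y. \<lbrakk>x \<in> ?C n; y \<in> ?C n\<rbrakk> \<Longrightarrow> x \<oplus>\<^bsub>A\<^esub> y \<in> ?C n"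
      using I_zero zero_hom_part I_closed I_add add_hom_part by blast+
    show ?thesis
      using that
    proof (induction rule: hom_part_induct)
      case zero
      then show ?case using decomposes_zero[of ?C, OF C(1)] zc by simp
    next
      case (homogeneous m x)
      \<comment> \<open>Multiplication by \<open>z\<close> shifts degrees by \<open>n\<close>, so
        homogeneous summands of \<open>a\<close> yield homogeneous elements of the ideal.\<close>
      then have "z \<otimes>\<^bsub>A\<^esub> x \<in> ?C (n + m)"
        using mult_hom_part[OF centre_hom_part[OF z]] hom_part_closed by blast
      from decomposes_homogeneous[of ?C, OF C(1,2) this] show ?case by blast
    next
      case (add x y)
      then show ?case using decomposes_add[of ?C, OF C(2,3)] zc by (fastforce simp: r_distr)
    qed
  qed
  ultimately show ?thesis
    by (auto simp: dg_ideal_def graded_subset_def diff_stable_def)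
qed

end

section \<open>The dg-simple case\<close>

context dg_simple_algebra
begin

text \<open>The dg-ideal \<open>z A\<close> contains \<open>z\<close> as \<open>z\<close> times 1,
  hence is not zero; by dg-simplicity it contains 1. The inverse found this way is then replaced by
  one of degree \<open>- n\<close>, which is central.\<close>

lemma central_cycle_invertible:
  assumes z: "z \<in> Z n" and dz: "diff A z = \<zero>\<^bsub>A\<^esub>" and nz: "z \<noteq> \<zero>\<^bsub>A\<^esub>"
  obtains a where "a \<in> Z (- n)" "z \<otimes>\<^bsub>A\<^esub> a = \<one>\<^bsub>A\<^esub>"
proof -
  note zc = centre_closed[OF z]
  have "z \<in> (\<lambda>a. z \<otimes>\<^bsub>A\<^esub> a) ` carrier A"
    using zc by (auto intro: image_eqI[of _ _ "\<one>\<^bsub>A\<^esub>"])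
  then have "(\<lambda>a. z \<otimes>\<^bsub>A\<^esub> a) ` carrier A = carrier A"
    using dg_ideal_trivial[OF dg_ideal_central_cycle[OF z dz]] nz by auto
  then obtain a where "a \<in> carrier A" "z \<otimes>\<^bsub>A\<^esub> a = \<one>\<^bsub>A\<^esub>"
    using one_closed by (metis imageE)
  then show ?thesis
    using homogeneous_right_inverse[OF centre_hom_part[OF z]] homogeneous_inverse_central[OF z] that
    by metis
qed

section \<open>One-sided dg-ideals of the graded centre\<close>

lemma graded_diff_stable_contains_unit:
  assumes sub: "additive_subgroup I (graded_centre A)"
    and graded: "graded_subset I (graded_centre A)" and stable: "diff_stable I (graded_centre A)"
    and nontrivial: "I \<noteq> {\<zero>\<^bsub>A\<^esub>}"
  obtains z a n where "z \<in> I" "z \<in> Z n" "a \<in> Z (- n)" "z \<otimes>\<^bsub>A\<^esub> a = \<one>\<^bsub>A\<^esub>"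
proof -
  have "\<zero>\<^bsub>A\<^esub> \<in> I" using additive_subgroup.zero_closed[OF sub] by simp
  with nontrivial obtain x where x: "x \<in> I" "x \<noteq> \<zero>\<^bsub>A\<^esub>" by blast
  then obtain f where f: "decomposes (graded_centre A) (\<lambda>n. I \<inter> Z n) f x"
    using graded by (auto simp: graded_subset_def)
  \<comment> \<open>If every component vanished, \<open>x\<close> would be an empty sum and hence
    zero.\<close>
  have "\<exists>n. f n \<noteq> \<zero>\<^bsub>A\<^esub>"
  proof (rule ccontr)
    interpret C: ring "graded_centre A" by (rule ring_graded_centre)
    assume "\<not> ?thesis"
    then have "{n. f n \<noteq> \<zero>\<^bsub>A\<^esub>} = {}" by simp
    then show False using f x(2) by (simp add: decomposes_def)
  qed
  then obtain n where n: "f n \<noteq> \<zero>\<^bsub>A\<^esub>" ..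
  define y where "y = f n"
  have y: "y \<in> I" "y \<in> Z n" "y \<noteq> \<zero>\<^bsub>A\<^esub>"
    using f n by (auto simp: decomposes_def y_def)
  \<comment> \<open>Either \<open>y\<close> is a cycle already, or \<open>diff A y\<close> is a
    nonzero one: it stays in \<open>I\<close> by stability and in the centre by
    \<open>diff_centre\<close>, with degree raised by one.\<close>
  obtain z m where z: "z \<in> I" "z \<in> Z m" "z \<noteq> \<zero>\<^bsub>A\<^esub>" "diff A z = \<zero>\<^bsub>A\<^esub>"
  proof (cases "diff A y = \<zero>\<^bsub>A\<^esub>")
    case False
    moreover have "diff A y \<in> I" using stable y(1) by (simp add: diff_stable_def)
    ultimately show ?thesis
      using that diff_centre[OF y(2)] diff_diff[OF centre_closed[OF y(2)]] by blast
  qed (use y that in blast)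
  then obtain a where "a \<in> Z (- m)" "z \<otimes>\<^bsub>A\<^esub> a = \<one>\<^bsub>A\<^esub>"
    using central_cycle_invertible by metis
  with z that show ?thesis by blast
qed

text \<open>A left ideal absorbs factors on the left of \<open>z\<close>, whereas the available
  inverse stands on its right; graded commutativity turns it into a left inverse.\<close>

lemma dg_left_ideal_graded_centre_trivial:
  assumes "dg_left_ideal I (graded_centre A)"
  shows "I = {\<zero>\<^bsub>A\<^esub>} \<or> I = ZA"
proof (cases "I = {\<zero>\<^bsub>A\<^esub>}")
  case False
  moreover have I: "additive_subgroup I (graded_centre A)"
    and left: "\<And>b x. \<lbrakk>b \<in> ZA; x \<in> I\<rbrakk> \<Longrightarrow> b \<otimes>\<^bsub>A\<^esub> x \<in> I"
    using assms by (auto simp: dg_left_ideal_def)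
  ultimately obtain z a n where z: "z \<in> I" "z \<in> Z n" "a \<in> Z (- n)" "z \<otimes>\<^bsub>A\<^esub> a = \<one>\<^bsub>A\<^esub>"
    using assms graded_diff_stable_contains_unit by (metis dg_left_ideal_def)
  \<comment> \<open>The sign is the one that arises from interchanging \<open>z\<close> and
    \<open>a\<close>, of degrees \<open>n\<close> and \<open>- n\<close>.\<close>
  have "signed A (n * - n) a \<in> Z (- n)"
    using z(3) minus_centre by (simp add: signed_def)
  moreover have "signed A (n * - n) a \<otimes>\<^bsub>A\<^esub> z = \<one>\<^bsub>A\<^esub>"
    using z centre_commute'[OF z(3) centre_hom_part[OF z(2)]] centre_closed
    by (simp add: signed_mult_left)
  ultimately have "\<one>\<^bsub>A\<^esub> \<in> I"
    using left[OF ZA_homogeneous z(1)] by metis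
  then have "b \<in> I" if "b \<in> ZA" for b
    using left[OF that, of "\<one>\<^bsub>A\<^esub>"] ZA_closed[OF that] by simp
  then show ?thesis using additive_subgroup.a_subset[OF I] by blast
qed simp

text \<open>The inverse of \<open>z\<close> already stands on the right, so 1 lies in
  \<open>I\<close> without any change of sign.\<close>

lemma dg_right_ideal_graded_centre_trivial:
  assumes "dg_right_ideal I (graded_centre A)"
  shows "I = {\<zero>\<^bsub>A\<^esub>} \<or> I = ZA"
proof (cases "I = {\<zero>\<^bsub>A\<^esub>}")
  case False
  moreover have I: "additive_subgroup I (graded_centre A)"
    and right: "\<And>b x. \<lbrakk>b \<in> ZA; x \<in> I\<rbrakk> \<Longrightarrow> x \<otimes>\<^bsub>A\<^esub> b \<in> I"
    using assms by (auto simp: dg_right_ideal_def)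
  ultimately obtain z a n where z: "z \<in> I" "z \<in> Z n" "a \<in> Z (- n)" "z \<otimes>\<^bsub>A\<^esub> a = \<one>\<^bsub>A\<^esub>"
    using assms graded_diff_stable_contains_unit by (metis dg_right_ideal_def)
  then have "\<one>\<^bsub>A\<^esub> \<in> I"
    using right[OF ZA_homogeneous z(1)] by metis
  then have "b \<in> I" if "b \<in> ZA" for b
    using right[OF that, of "\<one>\<^bsub>A\<^esub>"] ZA_closed[OF that] by simp
  then show ?thesis using additive_subgroup.a_subset[OF I] by blast
qed simp

end

theorem lemma2p17:
  fixes K :: "('k, 'm) ring_scheme" and A :: "('k, 'a, 'n) dg_struct_scheme"
  assumes "dg_simple_algebra K A"
  shows "dg_division_algebra K (graded_centre A)"
proof -
  interpret dg_simple_algebra K A by (rule assms)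
  show ?thesis
    using dg_left_ideal_graded_centre_trivial dg_right_ideal_graded_centre_trivial
    by (intro dg_division_algebra.intro dg_division_algebra_axioms.intro dg_algebra_graded_centre)
      auto
qed

end
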